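(* For all integers $n\geq 0$ the following identities hold (the first as formal power series in $x$ whose coefficients are polynomials in $p,q$, the second as rational functions in $s,t$): (a) $\displaystyle G_{n+1}(p,q,x) = \frac{p}{p-q}\left[ G_n(q,p,x) - G_n(q,q,x) \right]$; (b) $\displaystyle U_{n+1}(s,t) = \frac{1-t}{s-t}\left[ \left(\frac{1-t}{1-s}\right)^{n+1} s\,U_n(t,s) - t\,U_n(t,t) \right]$.
   Context: For $n\geq1$, the zig-zag poset $Z_n$ is the poset on $[n]=\{1,\dots,n\}$ generated by the relations $j<_{Z_n} j+1$ for odd $j\in[n-1]$ and $j>_{Z_n} j+1$ for even $j\in[n-1]$. Let $\mathcal{A}_n(m)$ be the set of functions $f:[n]\to\{1,\dots,m\}$ with $f(j)\leq f(j+1)$ for odd $j\in[n-1]$ and $f(j)\geq f(j+1)$ for even $j\in[n-1]$ (bounded relaxed $Z_n$-partitions). For $n\ge1$, $m\ge1$ put $\Omega_n(p,q;m)=\sum_{f\in\mathcal{A}_n(m)} p^{f(1)}q^{m+1-f(1)}$, and define $G_n(p,q,x)=\sum_{m\geq1}\Omega_n(p,q;m)x^m$ for $n\geq1$, with $G_0(p,q,x)=pqx/(1-qx)$. For a permutation $w\in S_n$, $\mathrm{Ret}_1(w)=\{\,i\in[n-1] : w^{-1}(i)>w^{-1}(i+1)+1\,\}$ is the set of big returns. Let $U_n$ be the set of up-down alternating permutations $u\in S_n$, i.e. $u(1)<u(2)>u(3)<\cdots$. For $u\in U_n$ let $\mathrm{ret}_1^-(u)=|\mathrm{Ret}_1(u)\cap\{1,\dots,u(1)\}|$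 and $\mathrm{ret}_1^+(u)=|\mathrm{Ret}_1(u)\cap\{u(1)+1,\dots,n-1\}|$. For $n\geq1$ define $U_n(s,t)=\sum_{u\in U_n} s^{\mathrm{ret}_1^-(u)}t^{\mathrm{ret}_1^+(u)}\left(\frac{1-t}{1-s}\right)^{u(1)}$, and $U_0(s,t)=1$. *)

theory Defs
  imports
    "HOL-Combinatorics.Permutations"
    "HOL-Library.FuncSet"
    "HOL-Computational_Algebra.Computational_Algebra"
begin

type_synonym ratfun2 = "rat poly poly fract"

definition indet1 :: ratfun2 where
  "indet1 = to_fract [:[:0, 1:]:]"

definition indet2 :: ratfun2 where
  "indet2 = to_fract [:0, 1:]"

text \<open>
  The polynomials and rational functions below are defined by evaluating their defining
  formulas at elements of a field. Evaluation at the indeterminates gives the objects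
  themselves, and exchanging or identifying the indeterminates is evaluation at the
  corresponding elements.
\<close>

definition relaxed_partitions :: "nat \<Rightarrow> nat \<Rightarrow> (nat \<Rightarrow> nat) set" where
  "relaxed_partitions n m =
     {f \<in> {1..n} \<rightarrow>\<^sub>E {1..m}.
        \<forall>j\<in>{1..<n}. (odd j \<longrightarrow> f j \<le> f (j + 1)) \<and> (even j \<longrightarrow> f j \<ge> f (j + 1))}"

definition Omega :: "nat \<Rightarrow> 'a::field \<Rightarrow> 'a \<Rightarrow> nat \<Rightarrow> 'a" where
  "Omega n p q m = (\<Sum>f\<in>relaxed_partitions n m. p ^ f 1 * q ^ (m + 1 - f 1))"

definition G :: "nat \<Rightarrow> 'a::field \<Rightarrow> 'a \<Rightarrow> 'a fps" where
  "G n p q =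
     (if n = 0 then fps_const (p * q) * fps_X / (1 - fps_const q * fps_X)
      else Abs_fps (\<lambda>m. if m \<ge> 1 then Omega n p q m else 0))"

definition Ret1 :: "nat \<Rightarrow> (nat \<Rightarrow> nat) \<Rightarrow> nat set" where
  "Ret1 n w = {i \<in> {1..n - 1}. inv w i > inv w (i + 1) + 1}"

definition updown_perms :: "nat \<Rightarrow> (nat \<Rightarrow> nat) set" where
  "updown_perms n =
     {u. u permutes {1..n} \<and>
        (\<forall>j\<in>{1..<n}. (odd j \<longrightarrow> u j < u (j + 1)) \<and> (even j \<longrightarrow> u j > u (j + 1)))}"

definition ret1_minus :: "nat \<Rightarrow> (nat \<Rightarrow> nat) \<Rightarrow> nat" where
  "ret1_minus n u = card (Ret1 n u \<inter> {1..u 1})"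

definition ret1_plus :: "nat \<Rightarrow> (nat \<Rightarrow> nat) \<Rightarrow> nat" where
  "ret1_plus n u = card (Ret1 n u \<inter> {u 1 + 1..n - 1})"

definition U :: "nat \<Rightarrow> 'a::field \<Rightarrow> 'a \<Rightarrow> 'a" where
  "U n s t =
     (if n = 0 then 1
      else \<Sum>u\<in>updown_perms n.
             s ^ ret1_minus n u * t ^ ret1_plus n u * ((1 - t) / (1 - s)) ^ u 1)"

end

theory Submission
  imports Defs "HOL-Library.Product_Lexorder"
begin

text \<open>
  Part (a): deleting the first entry of a relaxed partition of \<open>[n + 1]\<close> and complementing the
  rest by \<open>v \<mapsto> m + 1 - v\<close> gives a relaxed partition of \<open>[n]\<close>; summing over the deleted entry is a
  geometric sum.

  Part (b) is part (a) read through Stanley's theory of \<open>P\<close>-partitions. Standardizing a relaxed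
  partition, with ties broken by a natural labelling of the zig-zag poset, yields an up-down
  permutation \<open>u\<close>, and the partitions with standardization \<open>u\<close> are the weakly increasing chains of
  values that increase strictly at the big returns of \<open>u\<close>. The generating function of such chains
  is a product of geometric series in the gaps, whence
  \<open>G n p q (1 - q X) ^ (n + 1) = p q X U n (p X) (q X)\<close>.
\<close>

subsection \<open>The recurrence for \<open>G\<close>\<close>

definition alternating :: "('a \<Rightarrow> 'a \<Rightarrow> bool) \<Rightarrow> nat \<Rightarrow> (nat \<Rightarrow> 'a) \<Rightarrow> bool" where
  "alternating R n f \<longleftrightarrow>
     (\<forall>j\<in>{1..<n}. (odd j \<longrightarrow> R (f j) (f (j + 1))) \<and> (even j \<longrightarrow> R (f (j + 1)) (f j)))"

lemma alternatingD:
  assumes "alternating R n f" "1 \<le> j" "j < n"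
  shows "odd j \<Longrightarrow> R (f j) (f (j + 1))" "even j \<Longrightarrow> R (f (j + 1)) (f j)"
  using assms by (auto simp: alternating_def)

lemma alternating_Suc:
  assumes "n \<ge> 1"
  shows "alternating R (Suc n) f \<longleftrightarrow> R (f 1) (f (Suc 1)) \<and> alternating R\<inverse>\<inverse> n (\<lambda>j. f (Suc j))"
proof -
  have "{1..<Suc n} = insert 1 (Suc ` {1..<n})"
    using assms by auto
  then show ?thesis
    unfolding alternating_def by (auto simp del: image_Suc_atLeastLessThan)
qed

lemma alternating_cong:
  assumes "\<And>j k. j \<in> {1..n} \<Longrightarrow> k \<in> {1..n} \<Longrightarrow> R (f j) (f k) \<longleftrightarrow> S (g j) (g k)"
  shows "alternating R n f \<longleftrightarrow> alternating S n g"
  using assms unfolding alternating_def by (intro ball_cong) auto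

lemma relaxed_partitions_iff:
  "f \<in> relaxed_partitions n m \<longleftrightarrow> f \<in> {1..n} \<rightarrow>\<^sub>E {1..m} \<and> alternating (\<le>) n f"
  by (simp add: relaxed_partitions_def alternating_def)

lemma relaxed_partitions_PiE: "f \<in> relaxed_partitions n m \<Longrightarrow> f \<in> {1..n} \<rightarrow>\<^sub>E {1..m}"
  by (simp add: relaxed_partitions_iff)

lemma finite_relaxed_partitions: "finite (relaxed_partitions n m)"
  by (rule finite_subset[of _ "{1..n} \<rightarrow>\<^sub>E {1..m}"])
     (simp_all add: relaxed_partitions_iff subset_iff finite_PiE)

text \<open>The value at \<open>n = 0\<close> makes the defining formula of \<^const>\<open>G\<close> for \<open>n \<ge> 1\<close> valid for all \<open>n\<close>.\<close>

definition first_value :: "nat \<Rightarrow> (nat \<Rightarrow> nat) \<Rightarrow> nat" where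
  "first_value n f = (if n = 0 then 1 else f 1)"

lemma first_value_in:
  assumes "f \<in> relaxed_partitions n m" "m \<ge> 1"
  shows "first_value n f \<in> {1..m}"
  using assms by (auto simp: first_value_def relaxed_partitions_iff PiE_iff)

definition tail_complement :: "nat \<Rightarrow> nat \<Rightarrow> (nat \<Rightarrow> nat) \<Rightarrow> nat \<Rightarrow> nat" where
  "tail_complement n m f = (\<lambda>j\<in>{1..n}. m + 1 - f (Suc j))"

definition prepend_complement :: "nat \<Rightarrow> nat \<Rightarrow> nat \<Rightarrow> (nat \<Rightarrow> nat) \<Rightarrow> nat \<Rightarrow> nat" where
  "prepend_complement n m i g = (\<lambda>j\<in>{1..Suc n}. if j = 1 then i else m + 1 - g (j - 1))"

lemma tail_prepend_complement:
  assumes "g \<in> {1..n} \<rightarrow>\<^sub>E {1..m}"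
  shows "tail_complement n m (prepend_complement n m i g) = g"
proof
  fix j
  show "tail_complement n m (prepend_complement n m i g) j = g j"
    using PiE_mem[OF assms, of j] PiE_arb[OF assms, of j]
    by (cases "j \<in> {1..n}") (auto simp: tail_complement_def prepend_complement_def)
qed

lemma prepend_tail_complement:
  assumes "f \<in> {1..Suc n} \<rightarrow>\<^sub>E {1..m}"
  shows "prepend_complement n m (f 1) (tail_complement n m f) = f"
proof
  fix j
  have "f j \<le> m" if "j \<in> {1..Suc n}" using PiE_mem[OF assms that] by simp
  then show "prepend_complement n m (f 1) (tail_complement n m f) j = f j"
    using PiE_arb[OF assms, of j]
    by (cases j rule: nat.exhaust) (auto simp: tail_complement_def prepend_complement_def)
qed

lemma tail_complement_PiE:
  assumes "f \<in> {1..Suc n} \<rightarrow>\<^sub>E {1..m}"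
  shows "tail_complement n m f \<in> {1..n} \<rightarrow>\<^sub>E {1..m}"
proof -
  have "m + 1 - f (Suc j) \<in> {1..m}" if "j \<in> {1..n}" for j
    using PiE_mem[OF assms, of "Suc j"] that by auto
  then show ?thesis
    by (simp add: tail_complement_def)
qed

lemma prepend_complement_PiE:
  assumes "i \<in> {1..m}" "g \<in> {1..n} \<rightarrow>\<^sub>E {1..m}"
  shows "prepend_complement n m i g \<in> {1..Suc n} \<rightarrow>\<^sub>E {1..m}"
proof -
  have "m + 1 - g (j - 1) \<in> {1..m}" if "j \<in> {1..Suc n}" "j \<noteq> 1" for j
    using PiE_mem[OF assms(2), of "j - 1"] that by (cases j) auto
  then show ?thesis
    using assms(1) by (simp add: prepend_complement_def)
qed

lemma relaxed_partitions_Suc_iff: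
  assumes f: "f \<in> {1..Suc n} \<rightarrow>\<^sub>E {1..m}"
  shows "f \<in> relaxed_partitions (Suc n) m \<longleftrightarrow>
    tail_complement n m f \<in> relaxed_partitions n m \<and>
    f 1 \<in> {1..m + 1 - first_value n (tail_complement n m f)}"
proof (cases "n = 0")
  case True
  then show ?thesis
    using f tail_complement_PiE[OF f]
    by (auto simp: relaxed_partitions_iff alternating_def first_value_def PiE_iff)
next
  case False
  have bounds: "1 \<le> f j" "f j \<le> m" if "j \<in> {1..Suc n}" for j
    using PiE_mem[OF f that] by auto
  have "alternating (\<ge>) n (\<lambda>j. f (Suc j)) \<longleftrightarrow> alternating (\<le>) n (tail_complement n m f)"
  proof (rule alternating_cong)
    fix j k assume "j \<in> {1..n}" "k \<in> {1..n}"
    then show "f (Suc k) \<le> f (Suc j) \<longleftrightarrow> tail_complement n m f j \<le> tail_complement n m f k"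
      using bounds[of "Suc j"] bounds[of "Suc k"] by (auto simp: tail_complement_def)
  qed
  moreover have "f 1 \<le> f (Suc 1) \<longleftrightarrow> f 1 \<in> {1..m + 1 - first_value n (tail_complement n m f)}"
    using False bounds[of 1] bounds[of "Suc 1"]
    by (auto simp: first_value_def tail_complement_def)
  ultimately show ?thesis
    using False f tail_complement_PiE[OF f] alternating_Suc[of n "(\<le>)" f]
    by (auto simp: relaxed_partitions_iff conversep_iff[abs_def])
qed

lemma bij_betw_prepend_complement:
  assumes "m \<ge> 1"
  shows "bij_betw (\<lambda>(g, i). prepend_complement n m i g)
     (SIGMA g:relaxed_partitions n m. {1..m + 1 - first_value n g}) (relaxed_partitions (Suc n) m)"
proof (rule bij_betw_byWitness[of _ "\<lambda>f. (tail_complement n m f, f 1)"])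
  let ?S = "SIGMA g:relaxed_partitions n m. {1..m + 1 - first_value n g}"
  have prepend: "g \<in> {1..n} \<rightarrow>\<^sub>E {1..m}" "prepend_complement n m i g \<in> {1..Suc n} \<rightarrow>\<^sub>E {1..m}"
    "prepend_complement n m i g 1 = i" if "(g, i) \<in> ?S" for g i
  proof -
    show g: "g \<in> {1..n} \<rightarrow>\<^sub>E {1..m}"
      using that by (auto simp: relaxed_partitions_iff)
    have "i \<in> {1..m}"
      using that assms first_value_in[of g n m] by auto
    then show "prepend_complement n m i g \<in> {1..Suc n} \<rightarrow>\<^sub>E {1..m}"
      using g by (rule prepend_complement_PiE)
  qed (simp add: prepend_complement_def)
  show "\<forall>x\<in>?S. (\<lambda>f. (tail_complement n m f, f 1)) ((\<lambda>(g, i). prepend_complement n m i g) x) = x"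
    using prepend by (auto simp: tail_prepend_complement)
  show "\<forall>f\<in>relaxed_partitions (Suc n) m.
      (\<lambda>(g, i). prepend_complement n m i g) (tail_complement n m f, f 1) = f"
    using prepend_tail_complement by (simp add: relaxed_partitions_iff)
  show "(\<lambda>(g, i). prepend_complement n m i g) ` ?S \<subseteq> relaxed_partitions (Suc n) m"
    using prepend by (auto simp: relaxed_partitions_Suc_iff tail_prepend_complement)
  show "(\<lambda>f. (tail_complement n m f, f 1)) ` relaxed_partitions (Suc n) m \<subseteq> ?S"
    using relaxed_partitions_Suc_iff[OF relaxed_partitions_PiE] by blast
qed

lemma fps_nth_inverse_one_minus_const_X:
  "inverse (1 - fps_const c * fps_X) $ n = c ^ n" for c :: "'a::field"
proof -
  have "(1 - fps_const c * fps_X) * Abs_fps (\<lambda>n. c ^ n) = 1"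
  proof (rule fps_ext)
    show "((1 - fps_const c * fps_X) * Abs_fps (\<lambda>n. c ^ n)) $ k = 1 $ k" for k
      by (cases k) (simp_all add: left_diff_distrib mult.assoc)
  qed
  then have "inverse (1 - fps_const c * fps_X) = Abs_fps (\<lambda>n. c ^ n)"
    by (rule fps_inverse_unique)
  then show ?thesis by simp
qed

lemma G_nth:
  "G n p q $ m =
     (if m = 0 then 0
      else \<Sum>f\<in>relaxed_partitions n m. p ^ first_value n f * q ^ (m + 1 - first_value n f))"
proof (cases "n = 0")
  case True
  then have "relaxed_partitions n m = {\<lambda>_. undefined}"
    by (auto simp: relaxed_partitions_iff alternating_def)
  then show ?thesis
    using True
    by (cases m)
       (simp_all add: G_def first_value_def fps_divide_unit mult.assoc
         fps_nth_inverse_one_minus_const_X)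
qed (simp add: G_def Omega_def first_value_def)

lemma sum_mixed_powers:
  fixes p q :: "'a::comm_ring_1"
  assumes "k \<le> N"
  shows "(p - q) * (\<Sum>i=1..k. p ^ i * q ^ (N - i)) = p * (p ^ k * q ^ (N - k) - q ^ N)"
proof -
  have "(\<Sum>i=1..k. p ^ i * q ^ (N - i)) = (\<Sum>i<k. p ^ Suc i * q ^ (N - Suc i))"
    by (simp add: sum.atLeast1_atMost_eq)
  also have "\<dots> = p * q ^ (N - k) * (\<Sum>i<k. q ^ (k - Suc i) * p ^ i)"
    unfolding sum_distrib_left
  proof (rule sum.cong[OF refl])
    fix i assume "i \<in> {..<k}"
    then have "q ^ (N - Suc i) = q ^ (N - k) * q ^ (k - Suc i)"
      using assms by (simp flip: power_add)
    then show "p ^ Suc i * q ^ (N - Suc i) = p * q ^ (N - k) * (q ^ (k - Suc i) * p ^ i)"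
      by (simp add: mult_ac)
  qed
  finally have "(p - q) * (\<Sum>i=1..k. p ^ i * q ^ (N - i)) = p * q ^ (N - k) * (p ^ k - q ^ k)"
    by (simp add: power_diff_sumr2 mult_ac)
  moreover have "q ^ N = q ^ (N - k) * q ^ k"
    using assms by (simp flip: power_add)
  ultimately show ?thesis by (simp add: algebra_simps)
qed

lemma G_Suc_nth:
  fixes p q :: "'a::field"
  shows "(p - q) * G (Suc n) p q $ m = p * (G n q p $ m - G n q q $ m)"
proof (cases "m = 0")
  case False
  then have m: "m \<ge> 1" by simp
  let ?v = "first_value n"
  have "G (Suc n) p q $ m =
      (\<Sum>(g, i)\<in>(SIGMA g:relaxed_partitions n m. {1..m + 1 - ?v g}). p ^ i * q ^ (m + 1 - i))"
    unfolding G_nth using False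
    by (simp add: sum.reindex_bij_betw[OF bij_betw_prepend_complement[OF m], symmetric]
        case_prod_unfold first_value_def prepend_complement_def)
  also have "\<dots> = (\<Sum>g\<in>relaxed_partitions n m. \<Sum>i=1..m + 1 - ?v g. p ^ i * q ^ (m + 1 - i))"
    by (rule sum.Sigma[symmetric]) (simp_all add: finite_relaxed_partitions)
  finally have "(p - q) * G (Suc n) p q $ m = (\<Sum>g\<in>relaxed_partitions n m.
      (p - q) * (\<Sum>i=1..m + 1 - ?v g. p ^ i * q ^ (m + 1 - i)))"
    by (simp only: sum_distrib_left)
  also have "\<dots> = (\<Sum>g\<in>relaxed_partitions n m.
      p * (q ^ ?v g * p ^ (m + 1 - ?v g) - q ^ ?v g * q ^ (m + 1 - ?v g)))"
  proof (rule sum.cong[OF refl])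
    fix g assume "g \<in> relaxed_partitions n m"
    then have v: "?v g \<in> {1..m}"
      using False first_value_in by simp
    then have "q ^ ?v g * q ^ (m + 1 - ?v g) = q ^ (m + 1)"
      by (simp flip: power_add)
    then show "(p - q) * (\<Sum>i=1..m + 1 - ?v g. p ^ i * q ^ (m + 1 - i)) =
        p * (q ^ ?v g * p ^ (m + 1 - ?v g) - q ^ ?v g * q ^ (m + 1 - ?v g))"
      using v sum_mixed_powers[of "m + 1 - ?v g" "m + 1" p q] by (simp add: mult.commute)
  qed
  also have "\<dots> = p * (G n q p $ m - G n q q $ m)"
    using False by (simp add: G_nth right_diff_distrib sum_subtractf sum_distrib_left)
  finally show ?thesis .
qed (simp add: G_nth)

theorem G_Suc:
  fixes p q :: "'a::field"
  assumes "p \<noteq> q"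
  shows "G (Suc n) p q = fps_const (p / (p - q)) * (G n q p - G n q q)"
proof (rule fps_ext)
  show "G (Suc n) p q $ m = (fps_const (p / (p - q)) * (G n q p - G n q q)) $ m" for m
    using G_Suc_nth[of p q n m] assms by (simp add: eq_divide_eq mult.commute)
qed

subsection \<open>Chains with prescribed minimal gaps\<close>

definition gap_chains :: "(nat \<Rightarrow> nat) \<Rightarrow> nat \<Rightarrow> nat \<Rightarrow> nat \<Rightarrow> (nat \<Rightarrow> nat) set" where
  "gap_chains r n l m =
     {a \<in> extensional {..n}. a 0 = l \<and> a n = m \<and> (\<forall>i<n. a i + r i \<le> a (Suc i))}"

lemma gap_chains_mono:
  assumes "a \<in> gap_chains r n l m" "i \<le> j" "j \<le> n"
  shows "a i \<le> a j"
proof (rule lift_Suc_mono_le_ivl[of "{..<n}" a])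
  show "a k \<le> a (Suc k)" if "k \<in> {..<n}" for k
    using assms(1) that by (auto simp: gap_chains_def dest: add_leD1)
qed (use assms in auto)

lemma gap_chains_bounds:
  assumes "a \<in> gap_chains r n l m" "i \<le> n"
  shows "l \<le> a i" "a i \<le> m"
  using gap_chains_mono[OF assms(1), of 0 i] gap_chains_mono[OF assms(1), of i n] assms
  by (simp_all add: gap_chains_def)

lemma finite_gap_chains: "finite (gap_chains r n l m)"
proof (rule finite_subset)
  show "gap_chains r n l m \<subseteq> {..n} \<rightarrow>\<^sub>E {..m}"
    using gap_chains_bounds(2) by (auto simp: PiE_def gap_chains_def)
qed (simp add: finite_PiE)

lemma gap_chains_0: "gap_chains r 0 l m = (if m = l then {\<lambda>i\<in>{..0}. l} else {})"
  by (auto simp: gap_chains_def extensional_def fun_eq_iff)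

lemma bij_betw_gap_chains_Suc:
  "bij_betw (\<lambda>(b, a). a(Suc n := m)) (SIGMA b:{b. b + r n \<le> m}. gap_chains r n l b)
     (gap_chains r (Suc n) l m)"
proof (rule bij_betw_byWitness[of _ "\<lambda>c. (c n, restrict c {..n})"])
  let ?S = "SIGMA b:{b. b + r n \<le> m}. gap_chains r n l b"
  show "\<forall>x\<in>?S. (\<lambda>c. (c n, restrict c {..n})) ((\<lambda>(b, a). a(Suc n := m)) x) = x"
    by (auto simp: gap_chains_def extensional_def fun_eq_iff)
  show "\<forall>c\<in>gap_chains r (Suc n) l m. (\<lambda>(b, a). a(Suc n := m)) (c n, restrict c {..n}) = c"
    by (auto simp: gap_chains_def extensional_def fun_eq_iff le_Suc_eq)
  show "(\<lambda>(b, a). a(Suc n := m)) ` ?S \<subseteq> gap_chains r (Suc n) l m"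
    by (auto simp: gap_chains_def extensional_def less_Suc_eq)
  show "(\<lambda>c. (c n, restrict c {..n})) ` gap_chains r (Suc n) l m \<subseteq> ?S"
    by (auto simp: gap_chains_def)
qed

definition gap_chain_gf :: "(nat \<Rightarrow> 'a::field) \<Rightarrow> (nat \<Rightarrow> nat) \<Rightarrow> nat \<Rightarrow> nat \<Rightarrow> 'a fps" where
  "gap_chain_gf y r n l = Abs_fps (\<lambda>m. \<Sum>a\<in>gap_chains r n l m. \<Prod>i<n. y i ^ (a (Suc i) - a i))"

lemma fps_nth_geometric_tail:
  fixes c :: "'a::field"
  shows "((fps_const c * fps_X) ^ r / (1 - fps_const c * fps_X)) $ d = (if r \<le> d then c ^ d else 0)"
proof -
  have "(fps_const c * fps_X) ^ r / (1 - fps_const c * fps_X) =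
      fps_X ^ r * (fps_const (c ^ r) * inverse (1 - fps_const c * fps_X))"
    by (simp add: fps_divide_unit power_mult_distrib mult_ac)
  then show ?thesis
    by (simp add: fps_X_power_mult_nth fps_nth_inverse_one_minus_const_X flip: power_add)
qed

lemma gap_chain_gf_Suc:
  "gap_chain_gf y r (Suc n) l =
     gap_chain_gf y r n l * ((fps_const (y n) * fps_X) ^ r n / (1 - fps_const (y n) * fps_X))"
  (is "_ = _ * ?t")
proof (rule fps_ext)
  fix m
  let ?w = "\<lambda>n a. \<Prod>i<n. y i ^ (a (Suc i) - a i)"
  let ?B = "{b. b + r n \<le> m}"
  have w: "?w (Suc n) (a(Suc n := m)) = ?w n a * y n ^ (m - b)" if "a \<in> gap_chains r n l b" for a b
    using that by (simp add: gap_chains_def)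
  have finB: "finite ?B"
    by (rule finite_subset[of _ "{..m}"]) auto
  have "gap_chain_gf y r (Suc n) l $ m =
      (\<Sum>(b, a)\<in>(SIGMA b:?B. gap_chains r n l b). ?w (Suc n) (a(Suc n := m)))"
    by (simp add: gap_chain_gf_def sum.reindex_bij_betw[OF bij_betw_gap_chains_Suc, symmetric]
        case_prod_unfold del: prod.lessThan_Suc)
  also have "\<dots> = (\<Sum>b\<in>?B. \<Sum>a\<in>gap_chains r n l b. ?w (Suc n) (a(Suc n := m)))"
    by (rule sum.Sigma[symmetric]) (simp_all add: finite_gap_chains finB)
  also have "\<dots> = (\<Sum>b\<in>?B. gap_chain_gf y r n l $ b * y n ^ (m - b))"
    by (simp add: w gap_chain_gf_def sum_distrib_right del: prod.lessThan_Suc fun_upd_apply)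
  also have "\<dots> = (\<Sum>b=0..m. gap_chain_gf y r n l $ b * ?t $ (m - b))"
    by (rule sum.mono_neutral_cong_left) (auto simp: fps_nth_geometric_tail)
  finally show "gap_chain_gf y r (Suc n) l $ m = (gap_chain_gf y r n l * ?t) $ m"
    by (simp add: fps_mult_nth)
qed

lemma gap_chain_gf_eq_prod:
  "gap_chain_gf y r n l =
     fps_X ^ l * (\<Prod>i<n. (fps_const (y i) * fps_X) ^ r i / (1 - fps_const (y i) * fps_X))"
proof (induction n)
  case 0
  then show ?case by (simp add: gap_chain_gf_def gap_chains_0 fps_eq_iff)
next
  case (Suc n)
  then show ?case by (simp add: gap_chain_gf_Suc mult.assoc)
qed

lemma prod_lessThan_split:
  fixes k n :: nat
  assumes "k \<le> n"
  shows "(\<Prod>i<n. f (i < k) i) = (\<Prod>i<k. f True i) * (\<Prod>i=k..<n. f False i)"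
proof -
  have "(\<Prod>i<n. f (i < k) i) = (\<Prod>i=0..<k. f (i < k) i) * (\<Prod>i=k..<n. f (i < k) i)"
    using assms prod.atLeastLessThan_concat[of 0 k n "\<lambda>i. f (i < k) i"]
    by (simp only: lessThan_atLeast0 le0)
  then show ?thesis by (simp add: lessThan_atLeast0)
qed

lemma prod_power_Suc_diff:
  fixes a :: "nat \<Rightarrow> nat"
  assumes "k \<le> n" "\<And>i. k \<le> i \<Longrightarrow> i < n \<Longrightarrow> a i \<le> a (Suc i)"
  shows "(\<Prod>i=k..<n. c ^ (a (Suc i) - a i)) = c ^ (a n - a k)"
  using assms
proof (induction n rule: dec_induct)
  case (step n)
  have mono: "a k \<le> a n" "a n \<le> a (Suc n)"
    using step.hyps step.prems by (auto intro: lift_Suc_mono_le_ivl[of "{k..<n}" a])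
  have "(\<Prod>i=k..<Suc n. c ^ (a (Suc i) - a i)) = c ^ (a n - a k) * c ^ (a (Suc n) - a n)"
    using step.IH step.prems step.hyps by simp
  then show ?case
    using mono by (simp flip: power_add)
qed simp

lemma prod_gap_chain_two_weights:
  fixes p q :: "'a::comm_monoid_mult"
  assumes a: "a \<in> gap_chains r n l m" and k: "k \<le> n"
  shows "(\<Prod>i<n. (if i < k then p else q) ^ (a (Suc i) - a i)) = p ^ (a k - l) * q ^ (m - a k)"
proof -
  have "(\<Prod>i=0..<k. p ^ (a (Suc i) - a i)) = p ^ (a k - a 0)"
    using k gap_chains_mono[OF a] by (intro prod_power_Suc_diff) auto
  moreover have "(\<Prod>i=k..<n. q ^ (a (Suc i) - a i)) = q ^ (a n - a k)"
    using k gap_chains_mono[OF a] by (intro prod_power_Suc_diff) auto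
  moreover have "a 0 = l" "a n = m"
    using a by (auto simp: gap_chains_def)
  ultimately show ?thesis
    using prod_lessThan_split[OF k, of "\<lambda>b i. (if b then p else q) ^ (a (Suc i) - a i)"]
    by (simp add: lessThan_atLeast0)
qed

lemma gap_chain_gf_two_weights:
  fixes p q :: "'a::field"
  assumes k: "k \<le> n"
  defines "s \<equiv> fps_const p * fps_X" and "t \<equiv> fps_const q * fps_X"
  shows "gap_chain_gf (\<lambda>i. if i < k then p else q) r n l * ((1 - s) ^ k * (1 - t) ^ (n - k)) =
    fps_X ^ l * s ^ (\<Sum>i<k. r i) * t ^ (\<Sum>i=k..<n. r i)"
proof -
  have geometric: "z / (1 - fps_const c * fps_X) = z * inverse (1 - fps_const c * fps_X)"
    for z and c :: 'a
    by (simp add: fps_divide_unit)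
  have cancel: "inverse (1 - fps_const c * fps_X) ^ j * (1 - fps_const c * fps_X) ^ j = 1"
    for c :: 'a and j
    by (simp add: inverse_mult_eq_1 flip: power_mult_distrib)
  have "gap_chain_gf (\<lambda>i. if i < k then p else q) r n l =
      fps_X ^ l * ((s ^ (\<Sum>i<k. r i) * inverse (1 - s) ^ k) *
      (t ^ (\<Sum>i=k..<n. r i) * inverse (1 - t) ^ (n - k)))"
    using prod_lessThan_split[OF k, of "\<lambda>b i. (fps_const (if b then p else q) * fps_X) ^ r i /
      (1 - fps_const (if b then p else q) * fps_X)"]
    by (simp add: gap_chain_gf_eq_prod s_def t_def geometric prod.distrib power_sum)
  then have "gap_chain_gf (\<lambda>i. if i < k then p else q) r n l * ((1 - s) ^ k * (1 - t) ^ (n - k)) =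
      fps_X ^ l * s ^ (\<Sum>i<k. r i) * t ^ (\<Sum>i=k..<n. r i) *
      (inverse (1 - s) ^ k * (1 - s) ^ k) * (inverse (1 - t) ^ (n - k) * (1 - t) ^ (n - k))"
    by (simp only: mult_ac)
  then show ?thesis
    unfolding s_def t_def cancel by simp
qed

subsection \<open>Standardization\<close>

definition standardization :: "nat \<Rightarrow> (nat \<Rightarrow> 'a::linorder) \<Rightarrow> nat \<Rightarrow> nat" where
  "standardization n key j = (if j \<in> {1..n} then card {k \<in> {1..n}. key k \<le> key j} else j)"

lemma standardization_less_iff:
  assumes "j \<in> {1..n}" "k \<in> {1..n}"
  shows "standardization n key j < standardization n key k \<longleftrightarrow> key j < key k"
proof -
  let ?S = "\<lambda>j. {k \<in> {1..n}. key k \<le> key j}"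
  have mono: "card (?S i) \<le> card (?S j)" if "key i \<le> key j" for i j
    using that by (intro card_mono) auto
  have "card (?S j) < card (?S k)" if "key j < key k"
  proof (rule psubset_card_mono)
    have "k \<in> ?S k - ?S j" using assms that by auto
    then show "?S j \<subset> ?S k" using that by auto
  qed simp
  then show ?thesis
    using assms mono[of k j] by (auto simp: standardization_def simp flip: not_le)
qed

lemma standardization_permutes:
  assumes "inj_on key {1..n}"
  shows "standardization n key permutes {1..n}"
proof (rule bij_imp_permutes)
  have inj: "inj_on (standardization n key) {1..n}"
  proof (rule inj_onI)
    fix j k assume jk: "j \<in> {1..n}" "k \<in> {1..n}"
      "standardization n key j = standardization n key k"
    then have "key j = key k"
      using standardization_less_iff[OF jk(1,2), of key] standardization_less_iff[OF jk(2,1), of key]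
      by simp
    then show "j = k"
      using assms jk(1,2) by (simp add: inj_on_eq_iff)
  qed
  have "standardization n key j \<in> {1..n}" if "j \<in> {1..n}" for j
  proof -
    let ?S = "{k \<in> {1..n}. key k \<le> key j}"
    have "card ?S \<le> card {1..n}" by (intro card_mono) auto
    moreover have "card ?S > 0" using that by (auto simp: card_gt_0_iff)
    ultimately show ?thesis using that by (simp add: standardization_def)
  qed
  then have "standardization n key ` {1..n} \<subseteq> {1..n}" by blast
  then show "bij_betw (standardization n key) {1..n} {1..n}"
    by (intro bij_betw_imageI endo_inj_surj inj) simp_all
qed (auto simp: standardization_def)

lemma card_permutes_le:
  fixes u :: "nat \<Rightarrow> nat"
  assumes u: "u permutes {1..n}" and j: "j \<in> {1..n}"
  shows "card {k \<in> {1..n}. u k \<le> u j} = u j"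
proof -
  have "u ` {k \<in> {1..n}. u k \<le> u j} = {i \<in> u ` {1..n}. i \<le> u j}" by auto
  also have "\<dots> = {1..u j}"
    using permutes_image[OF u] permutes_in_image[OF u, of j] j by auto
  finally show ?thesis
    using card_image[OF permutes_inj_on[OF u], of "{k \<in> {1..n}. u k \<le> u j}"] by simp
qed

lemma standardization_eq_iff:
  assumes u: "u permutes {1..n}" and inj: "inj_on key {1..n}"
  shows "standardization n key = u \<longleftrightarrow> strict_mono_on {1..n} (key \<circ> inv u)"
proof
  assume std: "standardization n key = u"
  show "strict_mono_on {1..n} (key \<circ> inv u)"
  proof (rule strict_mono_onI)
    fix i j assume ij: "i \<in> {1..n}" "j \<in> {1..n}" "i < j"
    then have "inv u i \<in> {1..n}" "inv u j \<in> {1..n}" "u (inv u i) < u (inv u j)"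
      using permutes_in_image[OF permutes_inv[OF u]] by (simp_all add: permutes_inverses[OF u])
    then show "(key \<circ> inv u) i < (key \<circ> inv u) j"
      using standardization_less_iff[of "inv u i" n "inv u j" key] std by simp
  qed
next
  assume mono: "strict_mono_on {1..n} (key \<circ> inv u)"
  show "standardization n key = u"
  proof
    fix j
    show "standardization n key j = u j"
    proof (cases "j \<in> {1..n}")
      case True
      have "{k \<in> {1..n}. key k \<le> key j} = {k \<in> {1..n}. u k \<le> u j}"
      proof (intro Collect_cong conj_cong refl)
        fix k assume "k \<in> {1..n}"
        then have "u k \<in> {1..n}" "u j \<in> {1..n}"
          using True by (simp_all only: permutes_in_image[OF u])
        from strict_mono_on_less_eq[OF mono this] show "key k \<le> key j \<longleftrightarrow> u k \<le> u j"
          by (simp add: permutes_inverses(2)[OF u])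
      qed
      then show ?thesis
        using True card_permutes_le[OF u True] by (simp add: standardization_def)
    next
      case False
      then show ?thesis
        using permutes_not_in[OF u, of j] by (auto simp: standardization_def)
    qed
  qed
qed

lemma strict_mono_on_interval_iff_Suc:
  fixes f :: "nat \<Rightarrow> 'a::order"
  shows "strict_mono_on {l..h} f \<longleftrightarrow> (\<forall>i\<in>{l..<h}. f i < f (Suc i))"
proof
  assume "strict_mono_on {l..h} f"
  then show "\<forall>i\<in>{l..<h}. f i < f (Suc i)"
    by (intro ballI) (rule strict_mono_onD, auto)
next
  assume step: "\<forall>i\<in>{l..<h}. f i < f (Suc i)"
  show "strict_mono_on {l..h} f"
  proof (rule strict_mono_onI)
    fix i j assume ij: "i \<in> {l..h}" "j \<in> {l..h}" "i < j"
    show "f i < f j"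
    proof (rule lift_Suc_mono_less_ivl[of "{l..<h}" f, OF _ \<open>i < j\<close>])
      show "{i..<j} \<subseteq> {l..<h}" using ij by auto
    qed (use step in blast)
  qed
qed

subsection \<open>Sorting relaxed partitions\<close>

definition zigzag_label :: "nat \<Rightarrow> nat" where
  "zigzag_label j = (if odd j then j - 1 else j + 1)"

definition zigzag_key :: "(nat \<Rightarrow> nat) \<Rightarrow> nat \<Rightarrow> nat \<times> nat" where
  "zigzag_key f j = (f j, zigzag_label j)"

lemma zigzag_label_less_iff:
  assumes "a \<noteq> b"
  shows "zigzag_label a < zigzag_label b \<longleftrightarrow>
    a + 1 < b \<or> b = a + 1 \<and> odd a \<or> a = b + 1 \<and> even b"
proof -
  have parity: "odd a \<noteq> odd b \<Longrightarrow> b \<noteq> a + 2" "odd a = odd b \<Longrightarrow> b \<noteq> a + 1"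
    by auto
  show ?thesis
    using assms parity odd_pos[of a] odd_pos[of b]
    by (cases "odd a"; cases "odd b") (auto simp: zigzag_label_def)
qed

lemma inj_zigzag_label: "inj zigzag_label"
proof (rule linorder_injI)
  fix a b :: nat assume "a < b"
  then consider "a + 1 < b" | "b = a + 1" by linarith
  then show "zigzag_label a \<noteq> zigzag_label b"
  proof cases
    case 1
    then show ?thesis using zigzag_label_less_iff[of a b] by simp
  next
    case 2
    then show ?thesis by (auto simp: zigzag_label_def)
  qed
qed

lemma inj_zigzag_key: "inj (zigzag_key f)"
  using inj_zigzag_label by (auto simp: zigzag_key_def inj_def)

lemma alternating_zigzag_key: "alternating (<) n (zigzag_key f) \<longleftrightarrow> alternating (\<le>) n f"
  unfolding alternating_def zigzag_key_def
  by (intro ball_cong) (auto simp: zigzag_label_less_iff)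

lemma updown_perms_iff: "u \<in> updown_perms n \<longleftrightarrow> u permutes {1..n} \<and> alternating (<) n u"
  by (simp add: updown_perms_def alternating_def)

lemma finite_updown_perms: "finite (updown_perms n)"
  by (rule finite_subset[of _ "{u. u permutes {1..n}}"])
     (auto simp: updown_perms_iff finite_permutations)

lemma standardization_zigzag_key_in_updown_perms_iff:
  "standardization n (zigzag_key f) \<in> updown_perms n \<longleftrightarrow> alternating (\<le>) n f"
proof -
  have "standardization n (zigzag_key f) permutes {1..n}"
    by (intro standardization_permutes inj_on_subset[OF inj_zigzag_key]) simp
  moreover have "alternating (<) n (standardization n (zigzag_key f)) \<longleftrightarrow>
      alternating (<) n (zigzag_key f)"
    by (intro alternating_cong standardization_less_iff)
  ultimately show ?thesis
    by (simp add: updown_perms_iff alternating_zigzag_key)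
qed

text \<open>Neighbours \<open>j\<close>, \<open>j + 1\<close> are comparable in the zig-zag poset, so for an up-down permutation
  a return that is not big is never a descent of the labels.\<close>

lemma mem_Ret1_iff_zigzag_label_less:
  assumes u: "u \<in> updown_perms n" and i: "i \<in> {1..<n}"
  shows "i \<in> Ret1 n u \<longleftrightarrow> zigzag_label (inv u (Suc i)) < zigzag_label (inv u i)"
proof -
  define a b where "a = inv u i" and "b = inv u (Suc i)"
  have perm: "u permutes {1..n}" and alt: "alternating (<) n u"
    using u by (simp_all add: updown_perms_iff)
  have ua: "u a = i" and ub: "u b = Suc i"
    using permutes_inverses(1)[OF perm] by (simp_all add: a_def b_def)
  have ab: "a \<in> {1..n}" "b \<in> {1..n}"
    using permutes_in_image[OF permutes_inv[OF perm]] i by (simp_all add: a_def b_def)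
  have "even b" if "a = b + 1"
    using alternatingD(1)[OF alt, of b] ab ua ub that by fastforce
  moreover have "odd a" if "b = a + 1"
    using alternatingD(2)[OF alt, of a] ab ua ub that by fastforce
  moreover have "a \<noteq> b" using ua ub by auto
  ultimately have "zigzag_label b < zigzag_label a \<longleftrightarrow> b + 1 < a"
    using zigzag_label_less_iff[of b a] by blast
  moreover have "i \<in> Ret1 n u \<longleftrightarrow> b + 1 < a"
    using i by (auto simp: Ret1_def a_def b_def)
  ultimately show ?thesis by (simp add: a_def b_def)
qed

lemma standardization_zigzag_key_eq_iff:
  assumes u: "u \<in> updown_perms n"
  shows "standardization n (zigzag_key f) = u \<longleftrightarrow>
    (\<forall>i\<in>{1..<n}. f (inv u i) + of_bool (i \<in> Ret1 n u) \<le> f (inv u (Suc i)))"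
proof -
  have perm: "u permutes {1..n}" using u by (simp add: updown_perms_iff)
  have "zigzag_key f (inv u i) < zigzag_key f (inv u (Suc i)) \<longleftrightarrow>
      f (inv u i) + of_bool (i \<in> Ret1 n u) \<le> f (inv u (Suc i))" if i: "i \<in> {1..<n}" for i
  proof -
    have "zigzag_label (inv u i) \<noteq> zigzag_label (inv u (Suc i))"
      using inj_zigzag_label permutes_inj[OF permutes_inv[OF perm]] by (simp add: inj_eq)
    then show ?thesis
      by (auto simp: zigzag_key_def mem_Ret1_iff_zigzag_label_less[OF u i])
  qed
  then show ?thesis
    by (simp add: standardization_eq_iff[OF perm inj_on_subset[OF inj_zigzag_key subset_UNIV]]
        strict_mono_on_interval_iff_Suc)
qed

definition sorting_fiber :: "nat \<Rightarrow> nat \<Rightarrow> (nat \<Rightarrow> nat) \<Rightarrow> (nat \<Rightarrow> nat) set" where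
  "sorting_fiber n m u = {f \<in> relaxed_partitions n m. standardization n (zigzag_key f) = u}"

lemma sorting_fiber_iff:
  assumes "u \<in> updown_perms n"
  shows "f \<in> sorting_fiber n m u \<longleftrightarrow> f \<in> {1..n} \<rightarrow>\<^sub>E {1..m} \<and>
    (\<forall>i\<in>{1..<n}. f (inv u i) + of_bool (i \<in> Ret1 n u) \<le> f (inv u (Suc i)))"
  using assms standardization_zigzag_key_in_updown_perms_iff[of n f]
  unfolding sorting_fiber_def relaxed_partitions_iff
    standardization_zigzag_key_eq_iff[OF assms, symmetric]
  by auto

abbreviation ret1_chains :: "nat \<Rightarrow> nat \<Rightarrow> (nat \<Rightarrow> nat) \<Rightarrow> (nat \<Rightarrow> nat) set" where
  "ret1_chains n m u \<equiv> gap_chains (\<lambda>i. of_bool (i \<in> Ret1 n u)) (Suc n) 1 m"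

abbreviation ret1_chain_gf :: "'a::field \<Rightarrow> 'a \<Rightarrow> nat \<Rightarrow> (nat \<Rightarrow> nat) \<Rightarrow> 'a fps" where
  "ret1_chain_gf p q n u \<equiv>
     gap_chain_gf (\<lambda>i. if i < u 1 then p else q) (\<lambda>i. of_bool (i \<in> Ret1 n u)) (Suc n) 1"

text \<open>With the bounds \<open>1\<close> and \<open>m\<close> adjoined as end points, the weight \<open>p ^ (f 1 - 1) * q ^ (m - f 1)\<close>
  becomes a product over the gaps of the chain.\<close>

definition chain_of_partition ::
    "nat \<Rightarrow> nat \<Rightarrow> (nat \<Rightarrow> nat) \<Rightarrow> (nat \<Rightarrow> nat) \<Rightarrow> nat \<Rightarrow> nat" where
  "chain_of_partition n m u f =
     (\<lambda>i\<in>{..Suc n}. if i = 0 then 1 else if i = Suc n then m else f (inv u i))"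

definition partition_of_chain :: "nat \<Rightarrow> (nat \<Rightarrow> nat) \<Rightarrow> (nat \<Rightarrow> nat) \<Rightarrow> nat \<Rightarrow> nat" where
  "partition_of_chain n u a = (\<lambda>j\<in>{1..n}. a (u j))"

lemma partition_of_chain_inv:
  assumes u: "u permutes {1..n}" and i: "i \<in> {1..n}"
  shows "partition_of_chain n u a (inv u i) = a i"
  using permutes_in_image[OF permutes_inv[OF u], of i] i
  by (simp add: partition_of_chain_def permutes_inverses(1)[OF u])

lemma chain_of_partition_of_chain:
  assumes u: "u permutes {1..n}" and a: "a \<in> gap_chains r (Suc n) 1 m"
  shows "chain_of_partition n m u (partition_of_chain n u a) = a"
proof
  fix i
  consider "i = 0" | "i = Suc n" | "i \<in> {1..n}" | "i > Suc n" by fastforce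
  then show "chain_of_partition n m u (partition_of_chain n u a) i = a i"
  proof cases
    case 3
    then show ?thesis
      using partition_of_chain_inv[OF u 3, of a] by (simp add: chain_of_partition_def)
  qed (use a in \<open>auto simp: chain_of_partition_def gap_chains_def extensional_def\<close>)
qed

lemma partition_of_chain_of_partition:
  assumes u: "u permutes {1..n}" and f: "f \<in> extensional {1..n}"
  shows "partition_of_chain n u (chain_of_partition n m u f) = f"
proof
  fix j
  show "partition_of_chain n u (chain_of_partition n m u f) j = f j"
  proof (cases "j \<in> {1..n}")
    case True
    then show ?thesis
      using permutes_in_image[OF u, of j]
      by (simp add: partition_of_chain_def chain_of_partition_def permutes_inverses(2)[OF u])
  next
    case False
    then show ?thesis
      using f by (auto simp: partition_of_chain_def extensional_def)
  qed
qed

lemma partition_of_chain_in_sorting_fiber: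
  assumes u: "u \<in> updown_perms n" and a: "a \<in> ret1_chains n m u"
  shows "partition_of_chain n u a \<in> sorting_fiber n m u"
  unfolding sorting_fiber_iff[OF u]
proof (intro conjI ballI)
  have perm: "u permutes {1..n}" using u by (simp add: updown_perms_iff)
  have "a (u j) \<in> {1..m}" if "j \<in> {1..n}" for j
    using gap_chains_bounds[OF a, of "u j"] permutes_in_image[OF perm, of j] that by simp
  then show "partition_of_chain n u a \<in> {1..n} \<rightarrow>\<^sub>E {1..m}"
    by (simp add: partition_of_chain_def)
  fix i assume i: "i \<in> {1..<n}"
  then have "i \<in> {1..n}" "Suc i \<in> {1..n}" by auto
  then show "partition_of_chain n u a (inv u i) + of_bool (i \<in> Ret1 n u)
      \<le> partition_of_chain n u a (inv u (Suc i))"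
    using a i by (simp add: partition_of_chain_inv[OF perm] gap_chains_def del: One_nat_def)
qed

lemma Ret1_subset: "Ret1 n u \<subseteq> {1..<n}"
  by (auto simp: Ret1_def)

lemma chain_of_partition_in_ret1_chains:
  assumes u: "u \<in> updown_perms n" and n: "n \<ge> 1" and f: "f \<in> sorting_fiber n m u"
  shows "chain_of_partition n m u f \<in> ret1_chains n m u"
proof -
  let ?c = "chain_of_partition n m u f"
  have perm: "u permutes {1..n}" using u by (simp add: updown_perms_iff)
  have step: "f (inv u i) + of_bool (i \<in> Ret1 n u) \<le> f (inv u (Suc i))" if "i \<in> {1..<n}" for i
    using f that by (simp add: sorting_fiber_iff[OF u])
  have range: "f (inv u i) \<in> {1..m}" if "i \<in> {1..n}" for i
    using f permutes_in_image[OF permutes_inv[OF perm], of i] that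
    unfolding sorting_fiber_iff[OF u] by (blast intro: PiE_mem)
  have "?c i + of_bool (i \<in> Ret1 n u) \<le> ?c (Suc i)" if "i < Suc n" for i
  proof -
    consider "i = 0" | "i = n" "i \<noteq> 0" | "i \<noteq> 0" "i \<noteq> n" by blast
    then show ?thesis
      using Ret1_subset[of n u] n range[of 1] range[of n] step[of i] that
      by cases (auto simp: chain_of_partition_def)
  qed
  then show ?thesis
    by (simp add: gap_chains_def chain_of_partition_def)
qed

lemma bij_betw_partition_of_chain:
  assumes u: "u \<in> updown_perms n" and n: "n \<ge> 1"
  shows "bij_betw (partition_of_chain n u) (ret1_chains n m u) (sorting_fiber n m u)"
proof (rule bij_betw_byWitness[of _ "chain_of_partition n m u"])
  have perm: "u permutes {1..n}" using u by (simp add: updown_perms_iff)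
  show "\<forall>a\<in>ret1_chains n m u. chain_of_partition n m u (partition_of_chain n u a) = a"
    using chain_of_partition_of_chain[OF perm] by blast
  show "\<forall>f\<in>sorting_fiber n m u. partition_of_chain n u (chain_of_partition n m u f) = f"
    using partition_of_chain_of_partition[OF perm] by (simp add: sorting_fiber_iff[OF u] PiE_def)
  show "partition_of_chain n u ` ret1_chains n m u \<subseteq> sorting_fiber n m u"
    using partition_of_chain_in_sorting_fiber[OF u] by blast
  show "chain_of_partition n m u ` sorting_fiber n m u \<subseteq> ret1_chains n m u"
    using chain_of_partition_in_ret1_chains[OF u n] by blast
qed

lemma updown_perms_first:
  assumes "u \<in> updown_perms n" "n \<ge> 1"
  shows "1 \<le> u 1" "u 1 \<le> n"
  using permutes_in_image[of u "{1..n}" 1] assms by (auto simp: updown_perms_iff)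

lemma sum_sorting_fiber:
  fixes p q :: "'a::field"
  assumes u: "u \<in> updown_perms n" and n: "n \<ge> 1"
  shows "(\<Sum>f\<in>sorting_fiber n m u. p ^ f 1 * q ^ (m + 1 - f 1)) =
    p * q * ret1_chain_gf p q n u $ m"
proof -
  have u1: "u 1 \<in> {1..n}" using updown_perms_first[OF u n] by simp
  have "(\<Sum>f\<in>sorting_fiber n m u. p ^ f 1 * q ^ (m + 1 - f 1)) =
      (\<Sum>a\<in>ret1_chains n m u. p ^ a (u 1) * q ^ (m + 1 - a (u 1)))"
    using n by (simp add: sum.reindex_bij_betw[OF bij_betw_partition_of_chain[OF u n], symmetric]
        partition_of_chain_def)
  also have "\<dots> = (\<Sum>a\<in>ret1_chains n m u. p * q * (p ^ (a (u 1) - 1) * q ^ (m - a (u 1))))"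
  proof (rule sum.cong[OF refl])
    fix a assume "a \<in> ret1_chains n m u"
    then have "1 \<le> a (u 1)" "a (u 1) \<le> m"
      using gap_chains_bounds[of a _ "Suc n" 1 m "u 1"] u1 by simp_all
    then have "p ^ a (u 1) = p * p ^ (a (u 1) - 1)" "q ^ (m + 1 - a (u 1)) = q * q ^ (m - a (u 1))"
      by (simp_all add: Suc_diff_le flip: power_Suc)
    then show "p ^ a (u 1) * q ^ (m + 1 - a (u 1)) =
        p * q * (p ^ (a (u 1) - 1) * q ^ (m - a (u 1)))"
      by (simp only: mult_ac)
  qed
  also have "\<dots> = p * q * ret1_chain_gf p q n u $ m"
    unfolding gap_chain_gf_def fps_nth_Abs_fps sum_distrib_left
    using u1 by (intro sum.cong refl) (simp add: prod_gap_chain_two_weights del: prod.lessThan_Suc)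
  finally show ?thesis .
qed

lemma G_eq_sum_ret1_chain_gf:
  fixes p q :: "'a::field"
  assumes n: "n \<ge> 1"
  shows "G n p q = fps_const (p * q) * (\<Sum>u\<in>updown_perms n. ret1_chain_gf p q n u)"
proof (rule fps_ext)
  fix m
  let ?w = "\<lambda>f. p ^ f 1 * q ^ (m + 1 - f 1)"
  have "{1..n} \<rightarrow>\<^sub>E {1..0::nat} = {}"
    using n by (auto simp: PiE_eq_empty_iff)
  then have "relaxed_partitions n 0 = {}"
    using relaxed_partitions_PiE by fastforce
  then have "G n p q $ m = (\<Sum>f\<in>relaxed_partitions n m. ?w f)"
    using n by (cases "m = 0") (simp_all add: G_def Omega_def)
  also have "\<dots> = (\<Sum>u\<in>updown_perms n. \<Sum>f\<in>sorting_fiber n m u. ?w f)"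
    unfolding sorting_fiber_def
  proof (rule sum.group[symmetric])
    show "(\<lambda>f. standardization n (zigzag_key f)) ` relaxed_partitions n m \<subseteq> updown_perms n"
      by (auto simp: relaxed_partitions_iff standardization_zigzag_key_in_updown_perms_iff)
  qed (rule finite_relaxed_partitions finite_updown_perms)+
  also have "\<dots> = (\<Sum>u\<in>updown_perms n. p * q * ret1_chain_gf p q n u $ m)"
    using n by (intro sum.cong refl sum_sorting_fiber)
  finally show "G n p q $ m = (fps_const (p * q) * (\<Sum>u\<in>updown_perms n. ret1_chain_gf p q n u)) $ m"
    by (simp add: fps_sum_nth sum_distrib_left)
qed

subsection \<open>The recurrence for \<open>U\<close>\<close>

definition U_numerator :: "nat \<Rightarrow> 'a::comm_ring_1 \<Rightarrow> 'a \<Rightarrow> 'a" where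
  "U_numerator n s t =
     (if n = 0 then 1
      else \<Sum>u\<in>updown_perms n.
             s ^ ret1_minus n u * t ^ ret1_plus n u * ((1 - s) ^ (n - u 1) * (1 - t) ^ u 1))"

lemma U_numerator_eq_U:
  fixes s t :: "'a::field"
  assumes "s \<noteq> 1"
  shows "U_numerator n s t = (1 - s) ^ n * U n s t"
proof (cases "n = 0")
  case False
  have "(1 - s) ^ (n - u 1) * (1 - t) ^ u 1 = (1 - s) ^ n * ((1 - t) / (1 - s)) ^ u 1"
    if "u \<in> updown_perms n" for u
    using updown_perms_first[OF that] False assms by (simp add: power_diff power_divide)
  then show ?thesis
    using False by (auto simp: U_numerator_def U_def sum_distrib_left mult_ac intro!: sum.cong)
qed (simp add: U_numerator_def U_def)

lemma fps_of_poly_U_numerator: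
  fixes a b :: "'a::field poly"
  shows "fps_of_poly (U_numerator n a b) = U_numerator n (fps_of_poly a) (fps_of_poly b)"
  by (simp add: U_numerator_def fps_of_poly_sum fps_of_poly_mult fps_of_poly_power fps_of_poly_diff)

lemma poly_U_numerator:
  fixes a b :: "'a::comm_ring_1 poly"
  shows "poly (U_numerator n a b) x = U_numerator n (poly a x) (poly b x)"
  by (simp add: U_numerator_def poly_sum)

lemma first_not_in_Ret1: "u permutes {1..n} \<Longrightarrow> u 1 \<notin> Ret1 n u"
  by (simp add: Ret1_def permutes_inverses)

lemma sum_of_bool_Ret1:
  assumes u: "u \<in> updown_perms n" and n: "n \<ge> 1"
  shows "(\<Sum>i<u 1. of_bool (i \<in> Ret1 n u)) = ret1_minus n u"
    and "(\<Sum>i=u 1..<Suc n. of_bool (i \<in> Ret1 n u)) = ret1_plus n u"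
proof -
  have "1 \<le> i \<and> i < n \<and> i \<noteq> u 1" if "i \<in> Ret1 n u" for i
    using that u Ret1_subset[of n u] first_not_in_Ret1[of u n] by (auto simp: updown_perms_iff)
  then have "{..<u 1} \<inter> Ret1 n u = Ret1 n u \<inter> {1..u 1}"
    and "{u 1..<Suc n} \<inter> Ret1 n u = Ret1 n u \<inter> {u 1 + 1..n - 1}"
    by (force simp: order_le_less)+
  then show "(\<Sum>i<u 1. of_bool (i \<in> Ret1 n u)) = ret1_minus n u"
    and "(\<Sum>i=u 1..<Suc n. of_bool (i \<in> Ret1 n u)) = ret1_plus n u"
    by (simp_all add: ret1_minus_def ret1_plus_def del: sum.op_ivl_Suc)
qed

lemma G_mult_eq_U_numerator:
  fixes p q :: "'a::field"
  defines "s \<equiv> fps_const p * fps_X" and "t \<equiv> fps_const q * fps_X"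
  shows "G n p q * ((1 - s) ^ n * (1 - t) ^ Suc n) = fps_const (p * q) * fps_X * U_numerator n s t"
proof (cases "n = 0")
  case True
  then show ?thesis
    by (simp add: G_def U_numerator_def fps_divide_unit mult.assoc inverse_mult_eq_1 t_def)
next
  case False
  then have n: "n \<ge> 1" by simp
  let ?gf = "ret1_chain_gf p q n"
  have "?gf u * ((1 - s) ^ n * (1 - t) ^ Suc n) =
      fps_X * (s ^ ret1_minus n u * t ^ ret1_plus n u * ((1 - s) ^ (n - u 1) * (1 - t) ^ u 1))"
    if u: "u \<in> updown_perms n" for u
  proof -
    have k: "u 1 \<le> n" by (rule updown_perms_first[OF u n])
    have "(1 - s) ^ n = (1 - s) ^ u 1 * (1 - s) ^ (n - u 1)"
      "(1 - t) ^ Suc n = (1 - t) ^ (Suc n - u 1) * (1 - t) ^ u 1"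
      using k by (simp_all flip: power_add)
    then have "?gf u * ((1 - s) ^ n * (1 - t) ^ Suc n) =
        (?gf u * ((1 - s) ^ u 1 * (1 - t) ^ (Suc n - u 1))) * ((1 - s) ^ (n - u 1) * (1 - t) ^ u 1)"
      by (simp only: mult_ac)
    also have "\<dots> = (fps_X ^ 1 * s ^ ret1_minus n u * t ^ ret1_plus n u) *
        ((1 - s) ^ (n - u 1) * (1 - t) ^ u 1)"
      unfolding s_def t_def gap_chain_gf_two_weights[OF le_SucI[OF k]] sum_of_bool_Ret1[OF u n] ..
    finally show ?thesis by (simp only: power_one_right mult_ac)
  qed
  then show ?thesis
    using False unfolding G_eq_sum_ret1_chain_gf[OF n] U_numerator_def
    by (simp add: sum_distrib_left sum_distrib_right mult.assoc cong: sum.cong)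
qed

lemma U_numerator_Suc_fps:
  fixes p q :: "'a::field"
  assumes "p \<noteq> q" "p \<noteq> 0" "q \<noteq> 0"
  defines "s \<equiv> fps_const p * fps_X" and "t \<equiv> fps_const q * fps_X"
  shows "fps_const (p - q) * (1 - t) ^ n * U_numerator (Suc n) s t =
    (1 - t) ^ (n + 2) * fps_const p * U_numerator n t s -
    (1 - s) ^ Suc n * (1 - t) * fps_const q * U_numerator n t t"
proof -
  define c where "c = fps_const (p * q) * fps_X"
  let ?G1 = "G (Suc n) p q" and ?G2 = "G n q p" and ?G3 = "G n q q"
  have G1: "?G1 * ((1 - s) ^ Suc n * (1 - t) ^ (n + 2)) = c * U_numerator (Suc n) s t"
    using G_mult_eq_U_numerator[of "Suc n" p q] by (simp add: s_def t_def c_def)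
  have G2: "?G2 * ((1 - t) ^ n * (1 - s) ^ Suc n) = c * U_numerator n t s"
    using G_mult_eq_U_numerator[of n q p] by (simp add: s_def t_def c_def mult.commute[of q p])
  have G3: "fps_const p * (?G3 * ((1 - t) ^ n * (1 - t) ^ Suc n)) =
      fps_const q * c * U_numerator n t t"
    using G_mult_eq_U_numerator[of n q q] by (simp add: t_def c_def mult_ac flip: fps_const_mult)
  have G: "fps_const (p - q) * ?G1 = fps_const p * (?G2 - ?G3)"
    using G_Suc[OF assms(1), of n] assms(1) by (simp add: mult.assoc[symmetric])
  have "c * (fps_const (p - q) * (1 - t) ^ n * U_numerator (Suc n) s t) =
      fps_const (p - q) * ?G1 * ((1 - s) ^ Suc n * (1 - t) ^ (n + 2) * (1 - t) ^ n)"
    using G1 by (simp only: mult_ac)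
  also have "\<dots> = (1 - t) ^ (n + 2) * fps_const p * (?G2 * ((1 - t) ^ n * (1 - s) ^ Suc n)) -
      (1 - s) ^ Suc n * (1 - t) * (fps_const p * (?G3 * ((1 - t) ^ n * (1 - t) ^ Suc n)))"
    unfolding G by (simp add: algebra_simps)
  also have "\<dots> = c * ((1 - t) ^ (n + 2) * fps_const p * U_numerator n t s -
      (1 - s) ^ Suc n * (1 - t) * fps_const q * U_numerator n t t)"
    unfolding G2 G3 by (simp only: right_diff_distrib mult_ac)
  finally show ?thesis
    using assms(2,3) by (simp add: c_def)
qed

text \<open>The identity of power series is one of polynomials in \<open>X\<close>, so one may put \<open>X = 1\<close>.\<close>

lemma U_numerator_Suc:
  fixes p q :: "'a::field"
  assumes "p \<noteq> q" "p \<noteq> 0" "q \<noteq> 0"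
  shows "(p - q) * (1 - q) ^ n * U_numerator (Suc n) p q =
    (1 - q) ^ (n + 2) * p * U_numerator n q p - (1 - p) ^ Suc n * (1 - q) * q * U_numerator n q q"
proof -
  let ?s = "[:0, p:]" and ?t = "[:0, q:]"
  let ?lhs = "[:p - q:] * (1 - ?t) ^ n * U_numerator (Suc n) ?s ?t"
  let ?rhs = "(1 - ?t) ^ (n + 2) * [:p:] * U_numerator n ?t ?s -
    (1 - ?s) ^ Suc n * (1 - ?t) * [:q:] * U_numerator n ?t ?t"
  have linear: "fps_of_poly [:0, c:] = fps_const c * fps_X" for c :: 'a
    by (simp add: fps_of_poly_pCons mult.commute)
  have "fps_of_poly ?lhs = fps_of_poly ?rhs"
    using U_numerator_Suc_fps[OF assms, of n]
    by (simp only: fps_of_poly_mult fps_of_poly_diff fps_of_poly_power fps_of_poly_U_numerator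
        fps_of_poly_1 fps_of_poly_const linear)
  then have "poly ?lhs 1 = poly ?rhs 1"
    by (simp only: fps_of_poly_eq_iff)
  then show ?thesis
    by (simp add: poly_U_numerator mult_ac del: power_Suc)
qed

theorem U_Suc:
  fixes s t :: "'a::field"
  assumes "s \<noteq> t" "s \<noteq> 0" "t \<noteq> 0" "s \<noteq> 1" "t \<noteq> 1"
  shows "U (Suc n) s t =
    (1 - t) / (s - t) * (((1 - t) / (1 - s)) ^ Suc n * s * U n t s - t * U n t t)"
proof -
  have nz: "1 - s \<noteq> 0" "1 - t \<noteq> 0" "s - t \<noteq> 0" using assms by simp_all
  define r where "r = ((1 - t) / (1 - s)) ^ Suc n"
  have r: "(1 - t) ^ Suc n = (1 - s) ^ Suc n * r"
    using nz by (simp add: r_def power_divide)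
  let ?d = "(1 - t) ^ n * (1 - s) ^ Suc n"
  have "?d * ((s - t) * U (Suc n) s t) = (s - t) * (1 - t) ^ n * U_numerator (Suc n) s t"
    unfolding U_numerator_eq_U[OF assms(4)] by (simp only: mult_ac)
  also have "\<dots> = (1 - t) ^ (n + 2) * s * U_numerator n t s -
      (1 - s) ^ Suc n * (1 - t) * t * U_numerator n t t"
    by (rule U_numerator_Suc[OF assms(1,2,3)])
  also have "\<dots> = (1 - t) ^ n * (1 - t) *
      ((1 - t) ^ Suc n * s * U n t s - (1 - s) ^ Suc n * t * U n t t)"
    using assms by (simp add: U_numerator_eq_U algebra_simps)
  also have "\<dots> = ?d * ((1 - t) * (r * s * U n t s - t * U n t t))"
    unfolding r by (simp only: right_diff_distrib mult_ac)
  finally have "(s - t) * U (Suc n) s t = (1 - t) * (r * s * U n t s - t * U n t t)"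
    using nz by simp
  then show ?thesis
    using nz(3) by (simp add: r_def eq_divide_eq mult.commute)
qed

lemma indets_distinct:
  "indet1 \<noteq> indet2" "indet1 \<noteq> 0" "indet2 \<noteq> 0" "indet1 \<noteq> 1" "indet2 \<noteq> 1"
  by (simp_all add: indet1_def indet2_def flip: to_fract_0 to_fract_1) (simp_all add: one_pCons)

theorem theorem1p1:
  fixes n :: nat and p q s t :: ratfun2
  assumes "p = indet1" and "q = indet2" and "s = indet1" and "t = indet2"
  shows "G (n + 1) p q = fps_const (p / (p - q)) * (G n q p - G n q q) \<and>
         U (n + 1) s t =
           (1 - t) / (s - t) * (((1 - t) / (1 - s)) ^ (n + 1) * s * U n t s - t * U n t t)"
proof
  show "G (n + 1) p q = fps_const (p / (p - q)) * (G n q p - G n q q)"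
    using G_Suc indets_distinct by (simp add: assms)
  show "U (n + 1) s t =
      (1 - t) / (s - t) * (((1 - t) / (1 - s)) ^ (n + 1) * s * U n t s - t * U n t t)"
    unfolding assms Suc_eq_plus1[symmetric] by (intro U_Suc indets_distinct)
qed

end
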